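(* Let $\varphi=f+\delta_\Omega$, where $\Omega\subseteq\mathbb{R}^n$ is a nonempty polyhedral set and $f:\mathbb{R}^n\to\mathbb{R}$ is a (possibly nonconvex) quadratic function which is lower bounded on $\Omega$. Let $\Sigma\in\mathbb{R}^{n\times n}$ be symmetric positive definite, let $x^0\in\mathbb{R}^n$, and let $(e^k)_{k\in\mathbb{N}}\subset\mathbb{R}^n$ be a sequence such that $\|e^k\|\in O(\rho^k)$ for some $\rho\in(0,1)$. Let $(x^k)_{k\in\mathbb{N}}$ be any sequence starting at $x^0$ and satisfying the inexact proximal point iterations $$x^{k+1}\in\operatorname{prox}_\varphi^{\Sigma}(x^k+e^k)\qquad\text{for all }k\in\mathbb{N}.$$ Then the sequence $(x^k)_{k\in\mathbb{N}}$ converges at $R$-linear rate to a stationary point of $\varphi$.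
   Context: $\delta_\Omega$ is the indicator function of $\Omega$: $\delta_\Omega(x)=0$ if $x\in\Omega$ and $+\infty$ otherwise. A quadratic function is one of the form $f(x)=\tfrac12x^\top Qx+q^\top x+c$ with $Q$ symmetric (possibly indefinite). $\|\cdot\|$ is the Euclidean norm and $\|x\|_{M}=\sqrt{\langle x,Mx\rangle}$ for $M$ symmetric positive definite. The proximal mapping of $\varphi$ with matrix stepsize $\Sigma$ is the set-valued mapping $$\operatorname{prox}_\varphi^{\Sigma}(x)=\operatorname*{argmin}_{w\in\mathbb{R}^n}\bigl\{\varphi(w)+\tfrac12\|w-x\|_{\Sigma^{-1}}^2\bigr\}.$$ A point $x$ is stationary for $\varphi$ if $0$ belongs to the regular subdifferential of $\varphi$ at $x$, i.e. $\varphi(x)<\infty$ and $\liminf_{x'\to x,\,x'\neq x}\frac{\varphi(x')-\varphi(x)}{\|x'-x\|}\ge0$. A sequence $(x^k)$ converges to $x^\star$ at $R$-linear rate if there exist $c>0$ and $r\in(0,1)$ such that $\|x^k-x^\star\|\le c\,r^k$ for all $k\in\mathbb{N}$. *)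

theory Defs
  imports "HOL-Analysis.Analysis" "HOL-Library.Landau_Symbols"
begin

definition symmetric_mat :: "real ^ 'n ^ 'n \<Rightarrow> bool" where
  "symmetric_mat M \<longleftrightarrow> transpose M = M"

definition sym_pos_def :: "real ^ 'n ^ 'n \<Rightarrow> bool" where
  "sym_pos_def M \<longleftrightarrow> symmetric_mat M \<and> (\<forall>x. x \<noteq> 0 \<longrightarrow> 0 < x \<bullet> (M *v x))"

definition quadratic_function :: "(real ^ 'n \<Rightarrow> real) \<Rightarrow> bool" where
  "quadratic_function f \<longleftrightarrow>
     (\<exists>Q q c. symmetric_mat Q \<and> (\<forall>x. f x = 1 / 2 * (x \<bullet> (Q *v x)) + q \<bullet> x + c))"

definition delta :: "'a set \<Rightarrow> 'a \<Rightarrow> ereal" where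
  "delta \<Omega> x = (if x \<in> \<Omega> then 0 else \<infinity>)"

definition norm_mat :: "real ^ 'n ^ 'n \<Rightarrow> real ^ 'n \<Rightarrow> real" where
  "norm_mat M x = sqrt (x \<bullet> (M *v x))"

text \<open>
  For a function that is identically \<open>\<infinity>\<close> this is the whole space rather than the empty set;
  the two conventions agree as soon as the function is finite somewhere.
\<close>

definition prox :: "real ^ 'n ^ 'n \<Rightarrow> (real ^ 'n \<Rightarrow> ereal) \<Rightarrow> real ^ 'n \<Rightarrow> (real ^ 'n) set" where
  "prox \<Sigma> \<phi> x =
     {w. is_arg_min (\<lambda>w. \<phi> w + ereal (1 / 2 * (norm_mat (matrix_inv \<Sigma>) (w - x))\<^sup>2)) (\<lambda>_. True) w}"

text \<open>
  The filter \<open>at x\<close> is the punctured neighbourhood filter, which encodes \<open>x' \<noteq> x\<close>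
  in the lower limit.
\<close>

definition stationary :: "(real ^ 'n \<Rightarrow> ereal) \<Rightarrow> real ^ 'n \<Rightarrow> bool" where
  "stationary \<phi> x \<longleftrightarrow>
     \<phi> x < \<infinity> \<and> 0 \<le> Liminf (at x) (\<lambda>x'. (\<phi> x' - \<phi> x) / ereal (norm (x' - x)))"

definition converges_R_linearly :: "(nat \<Rightarrow> 'a :: real_normed_vector) \<Rightarrow> 'a \<Rightarrow> bool" where
  "converges_R_linearly x l \<longleftrightarrow>
     (\<exists>c r. 0 < c \<and> 0 < r \<and> r < 1 \<and> (\<forall>k. norm (x k - l) \<le> c * r ^ k))"

end

theory Submission
  imports Defs
begin

text \<open>
  Along the iterates \<open>f\<close> decreases by a multiple of the squared step length, up to an error that is
  summable at a geometric rate, so the iterates are nearly stationary in the limit. By the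
  Karush--Kuhn--Tucker conditions and an error bound of Hoffman type, the value of \<open>f\<close> at a nearly
  stationary point differs from one of finitely many critical values by at most a constant times the
  squared residual. Eventually this critical value is the limit of \<open>f\<close> along the sequence, and
  descent and error bound together make the function values, hence the step lengths, decay
  geometrically.
\<close>

section \<open>Polyhedra\<close>

text \<open>A lower bound on \<open>f\<close> over \<open>\<Omega>\<close> controls function values
  only: the iterates are not known to be bounded, and stationary points need not be isolated. With
  no compactness at hand, the error bound must hold on all of \<open>\<Omega>\<close>, with
  smallness asked of the residual alone. Polyhedrality supplies this: for a fixed set of active
  constraints the pairs of point and residual form a polyhedron, and eliminating the point variables
  gives a Lipschitz estimate with one constant for the whole polyhedron. The square in the value
  bound comes from orthogonality, not from convexity. If two points satisfy the same constraints
  with equality and one of them is stationary with multipliers on these constraints, then their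
  difference is orthogonal to the gradient there, and only the quadratic term of the expansion is
  left.\<close>

lemma polyhedron_inequalities:
  fixes a :: "'i \<Rightarrow> 'a::euclidean_space"
  assumes "finite I"
  shows "polyhedron {x. \<forall>i\<in>I. a i \<bullet> x \<le> b i}"
proof -
  have "{x. \<forall>i\<in>I. a i \<bullet> x \<le> b i} = \<Inter> ((\<lambda>i. {x. a i \<bullet> x \<le> b i}) ` I)"
    by auto
  with assms show ?thesis
    by (auto simp: polyhedron_halfspace_le)
qed

lemma polyhedron_inequalitiesE:
  fixes P :: "'a::euclidean_space set"
  assumes "polyhedron P"
  obtains I :: "'a set set" and a b
  where "finite I" "P = {x. \<forall>i\<in>I. a i \<bullet> x \<le> b i}"
proof -
  obtain F where F: "finite F" "P = \<Inter>F" "\<forall>h\<in>F. \<exists>a b. a \<noteq> 0 \<and> h = {x. a \<bullet> x \<le> b}"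
    using assms unfolding polyhedron_def by blast
  then obtain a b where "\<And>h. h \<in> F \<Longrightarrow> h = {x. a h \<bullet> x \<le> b h}"
    by metis
  then have "P = {x. \<forall>h\<in>F. a h \<bullet> x \<le> b h}"
    using F(2) by auto
  with F(1) show thesis
    by (rule that)
qed

section \<open>Preimages and projections of polyhedra, with Hoffman-type estimates\<close>

lemma polyhedron_affine_vimage:
  fixes h :: "'a::euclidean_space \<Rightarrow> 'b::euclidean_space"
  assumes "polyhedron S" "linear h"
  shows "polyhedron {x. h x + c \<in> S}"
proof -
  obtain I :: "'b set set" and a b
    where I: "finite I" "S = {x. \<forall>i\<in>I. a i \<bullet> x \<le> b i}"
    using assms(1) by (rule polyhedron_inequalitiesE)
  have "{x. h x + c \<in> S} = {x. \<forall>i\<in>I. adjoint h (a i) \<bullet> x \<le> b i - a i \<bullet> c}"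
    by (simp add: I(2) inner_add_right adjoint_clauses(2)[OF assms(2)] algebra_simps)
  then show ?thesis
    using polyhedron_inequalities[OF I(1)] by simp
qed

text \<open>Fourier--Motzkin elimination; the witness is the largest of the lower bounds that the
  inequalities impose on the step length, and it is Lipschitz in \<open>z\<close>.\<close>

lemma polyhedron_plus_ray:
  fixes P :: "'a::euclidean_space set"
  assumes "polyhedron P"
  shows "polyhedron {z. \<exists>t\<ge>0. z - t *\<^sub>R u \<in> P}" (is "polyhedron ?R")
    and "\<exists>C\<ge>0. \<forall>p\<in>P. \<forall>z. (\<exists>t\<ge>0. z - t *\<^sub>R u \<in> P) \<longrightarrow>
           (\<exists>t. 0 \<le> t \<and> t \<le> C * norm (p - z) \<and> z - t *\<^sub>R u \<in> P)"
proof -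
  obtain I :: "'a set set" and a b
    where I: "finite I" and P: "P = {x. \<forall>i\<in>I. a i \<bullet> x \<le> b i}"
    using assms by (rule polyhedron_inequalitiesE)
  define J where "J = {i \<in> I. a i \<bullet> u > 0}"
  define l where "l i z = (a i \<bullet> z - b i) / (a i \<bullet> u)" for i z
  \<comment> \<open>Inserting 0 encodes the constraint that the step be nonnegative and keeps
    \<open>Max\<close> meaningful when \<open>J\<close> is empty.\<close>
  define T where "T z = Max (insert 0 ((\<lambda>i. l i z) ` J))" for z
  have J: "finite J"
    using I by (simp add: J_def)
  have T0: "T z \<ge> 0" for z
    unfolding T_def using J by (intro Max_ge) auto
  have Tl: "l i z \<le> T z" if "i \<in> J" for i z
    unfolding T_def using J that by (intro Max_ge) auto
  have T_cases: "T z = 0 \<or> (\<exists>j\<in>J. T z = l j z)" for z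
    using Max_in[of "insert 0 ((\<lambda>i. l i z) ` J)"] J unfolding T_def by auto
  have TP: "z - T z *\<^sub>R u \<in> P \<longleftrightarrow> (\<forall>i\<in>I - J. a i \<bullet> z - T z * (a i \<bullet> u) \<le> b i)" for z
  proof -
    have "a i \<bullet> z - T z * (a i \<bullet> u) \<le> b i" if "i \<in> J" for i
      using Tl[OF that, of z] that by (simp add: J_def l_def field_simps)
    then show ?thesis
      by (auto simp: P inner_diff_right)
  qed
  \<comment> \<open>Inequalities outside \<open>J\<close> never improve as the step grows, so they
    survive when a feasible step \<open>s\<close> is shortened to \<open>T z\<close>.\<close>
  have RT: "z - T z *\<^sub>R u \<in> P" if s: "s \<ge> 0" "z - s *\<^sub>R u \<in> P" for z s
    unfolding TP
  proof
    fix i assume i: "i \<in> I - J"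
    have "l j z \<le> s" if "j \<in> J" for j
      using s that by (auto simp: J_def l_def P field_simps inner_diff_right)
    with T_cases[of z] s have "T z \<le> s"
      by auto
    then have "s * (a i \<bullet> u) \<le> T z * (a i \<bullet> u)"
      using i by (intro mult_right_mono_neg) (auto simp: J_def)
    moreover have "a i \<bullet> z - s * (a i \<bullet> u) \<le> b i"
      using s i by (simp add: P inner_diff_right)
    ultimately show "a i \<bullet> z - T z * (a i \<bullet> u) \<le> b i"
      by simp
  qed
  \<comment> \<open>Substituting the step \<open>l j z\<close> into inequality \<open>i\<close>
    eliminates it: what remains is linear in \<open>z\<close>, one inequality per pair. The case
    \<open>T z = 0\<close> leaves inequality \<open>i\<close> itself.\<close>
  define c where "c i j = a i - ((a i \<bullet> u) / (a j \<bullet> u)) *\<^sub>R a j" for i j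
  define e where "e i j = b i - ((a i \<bullet> u) / (a j \<bullet> u)) * b j" for i j
  have ce: "a i \<bullet> z - l j z * (a i \<bullet> u) \<le> b i \<longleftrightarrow> c i j \<bullet> z \<le> e i j" for i j z
    by (simp add: l_def c_def e_def inner_diff_left algebra_simps diff_divide_distrib)
  have "?R = {z. \<forall>i\<in>I - J. a i \<bullet> z \<le> b i} \<inter>
             {z. \<forall>ij\<in>(I - J) \<times> J. c (fst ij) (snd ij) \<bullet> z \<le> e (fst ij) (snd ij)}"
    (is "_ = ?S")
  proof (intro set_eqI iffI)
    fix z assume "z \<in> ?R"
    then have *: "\<forall>i\<in>I - J. a i \<bullet> z - T z * (a i \<bullet> u) \<le> b i"
      using RT TP by blast
    have "a i \<bullet> z - t * (a i \<bullet> u) \<le> b i" if "i \<in> I - J" "t \<le> T z" for i t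
    proof -
      have "T z * (a i \<bullet> u) \<le> t * (a i \<bullet> u)"
        using that by (intro mult_right_mono_neg) (auto simp: J_def)
      moreover have "a i \<bullet> z - T z * (a i \<bullet> u) \<le> b i"
        using * that(1) by blast
      ultimately show ?thesis
        by linarith
    qed
    from this[of _ 0] this[of _ "l _ z"] T0 Tl show "z \<in> ?S"
      by (auto simp: ce)
  next
    fix z assume "z \<in> ?S"
    then have "z - T z *\<^sub>R u \<in> P"
      using T_cases[of z] unfolding TP by (auto simp: ce)
    then show "z \<in> ?R"
      using T0 by blast
  qed
  moreover have "polyhedron ?S"
    using I J by (intro polyhedron_Int polyhedron_inequalities) auto
  ultimately show "polyhedron ?R"
    by (simp only:)
  \<comment> \<open>Every \<open>l i\<close> is nonpositive on \<open>P\<close>, so \<open>T\<close>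
    vanishes there. \<open>C\<close> adds up the Lipschitz constants of the \<open>l i\<close> and
    thereby dominates each of them.\<close>
  define C where "C = (\<Sum>i\<in>J. norm (a i) / (a i \<bullet> u))"
  have nn: "norm (a i) / (a i \<bullet> u) \<ge> 0" if "i \<in> J" for i
    using that by (auto simp: J_def)
  have C: "norm (a i) / (a i \<bullet> u) \<le> C" if "i \<in> J" for i
    unfolding C_def using that J nn by (intro member_le_sum) auto
  have C0: "C \<ge> 0"
    unfolding C_def using nn by (intro sum_nonneg) auto
  have "T z \<le> C * norm (p - z)" if p: "p \<in> P" for p z
  proof -
    have "l j z \<le> C * norm (p - z)" if j: "j \<in> J" for j
    proof -
      have "a j \<bullet> z - b j \<le> a j \<bullet> (z - p)"
        using p j by (auto simp: P J_def inner_diff_right)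
      also have "\<dots> \<le> norm (a j) * norm (p - z)"
        by (metis norm_cauchy_schwarz norm_minus_commute)
      finally have "l j z \<le> norm (a j) / (a j \<bullet> u) * norm (p - z)"
        using j by (simp add: l_def J_def divide_right_mono)
      also have "\<dots> \<le> C * norm (p - z)"
        using C[OF j] by (intro mult_right_mono) auto
      finally show ?thesis .
    qed
    then show ?thesis
      using T_cases[of z] C0 by auto
  qed
  then show "\<exists>C\<ge>0. \<forall>p\<in>P. \<forall>z. (\<exists>t\<ge>0. z - t *\<^sub>R u \<in> P) \<longrightarrow>
           (\<exists>t. 0 \<le> t \<and> t \<le> C * norm (p - z) \<and> z - t *\<^sub>R u \<in> P)"
    using C0 RT T0 by blast
qed

text \<open>A line is the ray along \<open>u\<close> followed by the ray along \<open>- u\<close>.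
  The estimate now measures the distance from \<open>p\<close> to the shifted point instead of the
  step length, because in this form it composes over several directions.\<close>

lemma polyhedron_plus_line:
  fixes P :: "'a::euclidean_space set"
  assumes "polyhedron P"
  shows "polyhedron {z. \<exists>t. z - t *\<^sub>R u \<in> P}"
    and "\<exists>C\<ge>0. \<forall>p\<in>P. \<forall>z. (\<exists>t. z - t *\<^sub>R u \<in> P) \<longrightarrow>
           (\<exists>t. norm (p - (z - t *\<^sub>R u)) \<le> C * norm (p - z) \<and> z - t *\<^sub>R u \<in> P)"
proof -
  define R where "R = {z. \<exists>t\<ge>0. z - t *\<^sub>R u \<in> P}"
  have R: "polyhedron R"
    unfolding R_def by (rule polyhedron_plus_ray(1)[OF assms])
  have PR: "P \<subseteq> R"
    unfolding R_def by (auto intro: exI[of _ 0])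
  have line: "(\<exists>t. z - t *\<^sub>R u \<in> P) \<longleftrightarrow> (\<exists>s\<ge>0. z - s *\<^sub>R (- u) \<in> R)" for z
  proof
    assume "\<exists>t. z - t *\<^sub>R u \<in> P"
    then obtain t where t: "z - t *\<^sub>R u \<in> P" ..
    \<comment> \<open>\<open>t\<close> is split into its positive and negative parts, one for each
      ray.\<close>
    then have "z + max 0 (- t) *\<^sub>R u - max 0 t *\<^sub>R u \<in> P"
      by (cases "t \<ge> 0") auto
    then have "z - max 0 (- t) *\<^sub>R (- u) \<in> R"
      unfolding R_def by (auto intro!: exI[of _ "max 0 t"])
    then show "\<exists>s\<ge>0. z - s *\<^sub>R (- u) \<in> R"
      by (intro exI[of _ "max 0 (- t)"]) auto
  next
    assume "\<exists>s\<ge>0. z - s *\<^sub>R (- u) \<in> R"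
    then obtain s t where "z - s *\<^sub>R (- u) - t *\<^sub>R u \<in> P"
      unfolding R_def by blast
    then have "z - (t - s) *\<^sub>R u \<in> P"
      by (simp add: algebra_simps)
    then show "\<exists>t. z - t *\<^sub>R u \<in> P" ..
  qed
  show "polyhedron {z. \<exists>t. z - t *\<^sub>R u \<in> P}"
    unfolding line by (rule polyhedron_plus_ray(1)[OF R])
  obtain C where C: "C \<ge> 0" "\<And>p z. \<lbrakk>p \<in> P; \<exists>t\<ge>0. z - t *\<^sub>R u \<in> P\<rbrakk> \<Longrightarrow>
      \<exists>t. 0 \<le> t \<and> t \<le> C * norm (p - z) \<and> z - t *\<^sub>R u \<in> P"
    using polyhedron_plus_ray(2)[OF assms] by meson
  obtain D where D: "D \<ge> 0" "\<And>p z. \<lbrakk>p \<in> R; \<exists>t\<ge>0. z - t *\<^sub>R (- u) \<in> R\<rbrakk> \<Longrightarrow>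
      \<exists>t. 0 \<le> t \<and> t \<le> D * norm (p - z) \<and> z - t *\<^sub>R (- u) \<in> R"
    using polyhedron_plus_ray(2)[OF R] by meson
  define K where "K = (1 + C * norm u) * (1 + D * norm u)"
  show "\<exists>C\<ge>0. \<forall>p\<in>P. \<forall>z. (\<exists>t. z - t *\<^sub>R u \<in> P) \<longrightarrow>
           (\<exists>t. norm (p - (z - t *\<^sub>R u)) \<le> C * norm (p - z) \<and> z - t *\<^sub>R u \<in> P)"
  proof (rule exI[of _ K], intro conjI ballI allI impI)
    show "0 \<le> K"
      using C D by (simp add: K_def)
    fix p z assume p: "p \<in> P" and z: "\<exists>t. z - t *\<^sub>R u \<in> P"
    obtain s where s: "0 \<le> s" "s \<le> D * norm (p - z)" "z - s *\<^sub>R (- u) \<in> R"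
      using D(2)[of p z] p PR z line by blast
    define y where "y = z - s *\<^sub>R (- u)"
    have "\<exists>t\<ge>0. y - t *\<^sub>R u \<in> P"
      using s(3) unfolding R_def y_def by blast
    then obtain t where t: "0 \<le> t" "t \<le> C * norm (p - y)" "y - t *\<^sub>R u \<in> P"
      using C(2)[of p y] p by blast
    have "norm (p - y) \<le> norm (p - z) + norm (s *\<^sub>R u)"
      using norm_triangle_ineq4[of "p - z" "s *\<^sub>R u"] by (simp add: y_def algebra_simps)
    also have "\<dots> \<le> norm (p - z) + D * norm (p - z) * norm u"
      using s by (auto intro!: mult_right_mono)
    finally have y: "norm (p - y) \<le> (1 + D * norm u) * norm (p - z)"
      by (simp add: algebra_simps)
    have "norm (p - (y - t *\<^sub>R u)) \<le> norm (p - y) + norm (t *\<^sub>R u)"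
      using norm_triangle_ineq[of "p - y" "t *\<^sub>R u"] by (simp add: algebra_simps)
    also have "\<dots> \<le> norm (p - y) + C * norm (p - y) * norm u"
      using t by (auto intro!: mult_right_mono)
    also have "\<dots> = (1 + C * norm u) * norm (p - y)"
      by (simp add: algebra_simps)
    also have "\<dots> \<le> (1 + C * norm u) * ((1 + D * norm u) * norm (p - z))"
      using y C by (intro mult_left_mono) auto
    also have "\<dots> = K * norm (p - z)"
      by (simp add: K_def)
    finally have "norm (p - (y - t *\<^sub>R u)) \<le> K * norm (p - z)" .
    moreover have "y - t *\<^sub>R u = z - (t - s) *\<^sub>R u"
      by (simp add: y_def algebra_simps)
    ultimately show "\<exists>t. norm (p - (z - t *\<^sub>R u)) \<le> K * norm (p - z) \<and> z - t *\<^sub>R u \<in> P"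
      using t(3) by metis
  qed
qed

text \<open>Directions are added one at a time. Adding a line to \<open>P\<close> gives a polyhedron
  \<open>R\<close> containing \<open>P\<close>, to which the induction hypothesis is applied;
  therefore \<open>P\<close> stays arbitrary, and the constants multiply.\<close>

lemma polyhedron_plus_span:
  fixes P :: "'a::euclidean_space set"
  assumes "finite U" "polyhedron P"
  shows "polyhedron {z. \<exists>w\<in>span U. z - w \<in> P} \<and>
    (\<exists>C\<ge>0. \<forall>p\<in>P. \<forall>z. (\<exists>w\<in>span U. z - w \<in> P) \<longrightarrow>
           (\<exists>w\<in>span U. norm (p - (z - w)) \<le> C * norm (p - z) \<and> z - w \<in> P))"
  using assms
proof (induction U arbitrary: P rule: finite_induct)
  case empty
  then show ?case
    by (auto intro: exI[of _ 1])
next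
  case (insert u U)
  define R where "R = {z. \<exists>t. z - t *\<^sub>R u \<in> P}"
  have R: "polyhedron R"
    unfolding R_def by (rule polyhedron_plus_line(1)[OF insert.prems])
  have PR: "P \<subseteq> R"
    unfolding R_def by (auto intro: exI[of _ 0])
  have eq: "(\<exists>w\<in>span (insert u U). z - w \<in> P) \<longleftrightarrow> (\<exists>w\<in>span U. z - w \<in> R)" for z
  proof
    assume "\<exists>w\<in>span (insert u U). z - w \<in> P"
    then obtain w k where w: "z - w \<in> P" "w - k *\<^sub>R u \<in> span U"
      by (auto simp: span_insert)
    then have "z - (w - k *\<^sub>R u) - k *\<^sub>R u \<in> P"
      by simp
    with w(2) show "\<exists>w\<in>span U. z - w \<in> R"
      unfolding R_def by blast
  next
    assume "\<exists>w\<in>span U. z - w \<in> R"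
    then obtain w t where w: "w \<in> span U" "z - w - t *\<^sub>R u \<in> P"
      unfolding R_def by blast
    then have "w + t *\<^sub>R u \<in> span (insert u U)"
      by (auto simp: span_insert intro!: exI[of _ t])
    moreover have "z - (w + t *\<^sub>R u) \<in> P"
      using w(2) by (simp add: algebra_simps)
    ultimately show "\<exists>w\<in>span (insert u U). z - w \<in> P"
      by blast
  qed
  obtain C where C: "C \<ge> 0" "\<And>p z. \<lbrakk>p \<in> P; \<exists>t. z - t *\<^sub>R u \<in> P\<rbrakk> \<Longrightarrow>
      \<exists>t. norm (p - (z - t *\<^sub>R u)) \<le> C * norm (p - z) \<and> z - t *\<^sub>R u \<in> P"
    using polyhedron_plus_line(2)[OF insert.prems] by meson
  obtain D where D: "D \<ge> 0" "\<And>p z. \<lbrakk>p \<in> R; \<exists>w\<in>span U. z - w \<in> R\<rbrakk> \<Longrightarrow>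
      \<exists>w\<in>span U. norm (p - (z - w)) \<le> D * norm (p - z) \<and> z - w \<in> R"
    using insert.IH[OF R] by meson
  have "\<exists>w\<in>span (insert u U). norm (p - (z - w)) \<le> (C * D) * norm (p - z) \<and> z - w \<in> P"
    if p: "p \<in> P" and z: "\<exists>w\<in>span (insert u U). z - w \<in> P" for p z
  proof -
    obtain w where w: "w \<in> span U" "norm (p - (z - w)) \<le> D * norm (p - z)" "z - w \<in> R"
      using D(2)[of p z] p PR z eq by blast
    obtain t where t: "norm (p - (z - w - t *\<^sub>R u)) \<le> C * norm (p - (z - w))" "z - w - t *\<^sub>R u \<in> P"
      using C(2)[of p "z - w"] p w(3) R_def by blast
    have "norm (p - (z - w - t *\<^sub>R u)) \<le> C * (D * norm (p - z))"
      using t(1) mult_left_mono[OF w(2) C(1)] by simp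
    moreover have "w + t *\<^sub>R u \<in> span (insert u U)"
      using w(1) by (auto simp: span_insert intro!: exI[of _ t])
    ultimately show ?thesis
      using t(2) by (intro bexI[of _ "w + t *\<^sub>R u"]) (auto simp: algebra_simps)
  qed
  moreover have "0 \<le> C * D"
    using C D by simp
  moreover have "polyhedron {z. \<exists>w\<in>span (insert u U). z - w \<in> P}"
    unfolding eq using insert.IH[OF R] by blast
  ultimately show ?case
    by blast
qed

text \<open>Hoffman's bound for the fibre over the residual 0. The span of \<open>U\<close> consists
  of the vectors \<open>(e, 0)\<close>, so shifting \<open>z = (x, 0)\<close> along it back into
  \<open>P\<close> changes the point and keeps the residual 0, while the distance from
  \<open>(x, v)\<close> to \<open>z\<close> is just \<open>norm v\<close>.\<close>

lemma polyhedron_error_bound: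
  fixes P :: "('a::euclidean_space \<times> 'b::euclidean_space) set"
  assumes "polyhedron P"
  obtains C \<epsilon> where "C \<ge> 0" "\<epsilon> > 0"
    "\<And>x v. \<lbrakk>(x, v) \<in> P; norm v < \<epsilon>\<rbrakk> \<Longrightarrow> \<exists>y. (y, 0) \<in> P \<and> norm (x - y) \<le> C * norm v"
proof -
  define U :: "('a \<times> 'b) set" where "U = (\<lambda>e. (e, 0)) ` Basis"
  have "linear (\<lambda>e::'a. (e, 0::'b))"
    by (auto intro!: linearI)
  then have U: "span U = (\<lambda>e. (e, 0)) ` UNIV"
    unfolding U_def by (simp add: linear_span_image)
  define D where "D = {z. \<exists>w\<in>span U. z - w \<in> P}"
  have "finite U"
    by (simp add: U_def)
  with assms obtain C where D: "polyhedron D" and C: "C \<ge> 0"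
    "\<And>p z. \<lbrakk>p \<in> P; \<exists>w\<in>span U. z - w \<in> P\<rbrakk> \<Longrightarrow>
        \<exists>w\<in>span U. norm (p - (z - w)) \<le> C * norm (p - z) \<and> z - w \<in> P"
    using polyhedron_plus_span[of U P] unfolding D_def by meson
  have D_iff: "(x, v) \<in> D \<longleftrightarrow> (\<exists>y. (y, v) \<in> P)" for x v
  proof
    assume "\<exists>y. (y, v) \<in> P"
    then obtain y where "(x, v) - (x - y, 0) \<in> P"
      by auto
    then show "(x, v) \<in> D"
      unfolding D_def U by blast
  qed (auto simp: D_def U)
  show thesis
  proof (cases "(0, 0) \<in> D")
    case True
    have "\<exists>y. (y, 0) \<in> P \<and> norm (x - y) \<le> C * norm v" if xv: "(x, v) \<in> P" for x v
    proof -
      have "\<exists>w\<in>span U. (x, 0) - w \<in> P"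
        using True D_iff D_def by blast
      from C(2)[OF xv this] obtain u where
        u: "norm ((x, v) - ((x, 0) - (u, 0))) \<le> C * norm ((x, v) - (x, 0))" "(x, 0) - (u, 0) \<in> P"
        unfolding U by blast
      have "norm u \<le> norm ((x, v) - ((x, 0) - (u, 0)))"
        using norm_fst_le[of u v] by simp
      also have "\<dots> \<le> C * norm v"
        using u(1) by (simp add: norm_Pair)
      finally show ?thesis
        using u(2) by (intro exI[of _ "x - u"]) auto
    qed
    then show thesis
      using that[of C 1] C(1) by simp
  \<comment> \<open>Here the fibre over 0 is empty. Since \<open>D\<close> is closed, all residuals
    occurring in \<open>P\<close> stay away from 0, and the claim is vacuous below
    \<open>\<epsilon>\<close>.\<close>
  next
    case False
    then obtain \<epsilon> where e: "\<epsilon> > 0" "ball (0, 0) \<epsilon> \<subseteq> - D"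
      using polyhedron_imp_closed[OF D] by (meson ComplI open_Compl open_contains_ball)
    have "norm v \<ge> \<epsilon>" if "(x, v) \<in> P" for x v
    proof (rule ccontr)
      assume "\<not> norm v \<ge> \<epsilon>"
      then have "(0, v) \<in> ball (0, 0) \<epsilon>"
        by (simp add: dist_Pair_Pair)
      moreover have "(0, v) \<in> D"
        using that D_iff by blast
      ultimately show False
        using e by blast
    qed
    then show thesis
      using that[of 0 \<epsilon>] e(1) by force
  qed
qed

text \<open>Farkas' lemma. If \<open>w\<close> lay outside the closed cone, a separating
  \<open>d\<close> would make \<open>- d\<close> a feasible direction at \<open>x\<close>: active
  inequalities do not increase along it and inactive ones have slack. But \<open>w\<close> has a
  positive inner product with \<open>- d\<close>.\<close>

lemma normal_vector_in_active_cone: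
  fixes a :: "'i \<Rightarrow> 'a::euclidean_space"
  assumes I: "finite I" and x: "\<forall>i\<in>I. a i \<bullet> x \<le> b i"
    and w: "\<And>z. \<forall>i\<in>I. a i \<bullet> z \<le> b i \<Longrightarrow> w \<bullet> (z - x) \<le> 0"
  shows "w \<in> convex_cone hull (a ` {i\<in>I. a i \<bullet> x = b i})" (is "w \<in> ?K")
proof (rule ccontr)
  assume "w \<notin> ?K"
  moreover have "convex ?K" "closed ?K"
    using I by (auto intro!: closed_convex_cone_hull convex_convex_cone_hull)
  ultimately obtain d \<beta> where d: "d \<bullet> w < \<beta>" "\<And>k. k \<in> ?K \<Longrightarrow> d \<bullet> k > \<beta>"
    using separating_hyperplane_closed_point by meson
  have \<beta>: "\<beta> < 0"
    using d(2)[of 0] convex_cone_hull_contains_0 by force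
  have dK: "d \<bullet> k \<ge> 0" if "k \<in> ?K" for k
  proof (rule ccontr)
    assume neg: "\<not> d \<bullet> k \<ge> 0"
    \<comment> \<open>The factor is chosen so that \<open>d\<close> takes exactly the value
      \<open>\<beta>\<close> on the scaled vector, against strict separation.\<close>
    then have "(\<beta> / (d \<bullet> k)) *\<^sub>R k \<in> ?K"
      using \<beta> that by (intro convex_cone_hull_mul) (auto simp: divide_nonpos_neg)
    from d(2)[OF this] neg show False
      by simp
  qed
  have "eventually (\<lambda>t. \<forall>i\<in>I. a i \<bullet> (x - t *\<^sub>R d) \<le> b i) (at_right 0)"
  proof (intro eventually_ball_finite I ballI)
    fix i assume i: "i \<in> I"
    show "eventually (\<lambda>t. a i \<bullet> (x - t *\<^sub>R d) \<le> b i) (at_right 0)"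
    proof (cases "a i \<bullet> x = b i")
      case True
      then have "d \<bullet> a i \<ge> 0"
        using i by (intro dK hull_inc) auto
      with True show ?thesis
        by (auto simp: eventually_at_right_field inner_diff_right inner_commute intro!: exI[of _ 1])
    next
      case False
      have "((\<lambda>t. a i \<bullet> (x - t *\<^sub>R d)) \<longlongrightarrow> a i \<bullet> (x - 0 *\<^sub>R d)) (at_right 0)"
        by (intro tendsto_intros)
      moreover have "a i \<bullet> (x - 0 *\<^sub>R d) < b i"
        using False x i by force
      ultimately have "eventually (\<lambda>t. a i \<bullet> (x - t *\<^sub>R d) < b i) (at_right 0)"
        by (rule order_tendstoD)
      then show ?thesis
        by eventually_elim simp
    qed
  qed
  moreover have "eventually (\<lambda>t::real. t > 0) (at_right 0)"
    by (rule eventually_at_right_less)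
  ultimately have "eventually (\<lambda>t. t > 0 \<and> (\<forall>i\<in>I. a i \<bullet> (x - t *\<^sub>R d) \<le> b i)) (at_right (0::real))"
    by eventually_elim blast
  then obtain t where t: "t > 0" "\<forall>i\<in>I. a i \<bullet> (x - t *\<^sub>R d) \<le> b i"
    using eventually_happens'[of "at_right (0::real)"] trivial_limit_at_right_real by blast
  have "w \<bullet> (x - t *\<^sub>R d - x) \<le> 0"
    using w t(2) by blast
  then have "t * (d \<bullet> w) \<ge> 0"
    by (simp add: inner_commute)
  with t(1) d(1) \<beta> show False
    by (simp add: zero_le_mult_iff)
qed

section \<open>Quadratic functions\<close>

lemma convex_cone_hull_orthogonal:
  assumes "w \<in> convex_cone hull S" "\<And>s. s \<in> S \<Longrightarrow> s \<bullet> d = 0"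
  shows "w \<bullet> d = 0"
proof -
  have "convex_cone hull S \<subseteq> {w. w \<bullet> d = 0}"
    using assms(2)
    by (intro hull_minimal subspace_imp_convex_cone)
       (auto intro!: subspaceI simp: inner_add_left)
  with assms(1) show ?thesis
    by blast
qed

text \<open>Stated for a selfadjoint map on any Euclidean space; both the objective and the proximal
  subproblem, whose form is \<open>Q w + M w\<close>, are instances.\<close>

locale quadratic =
  fixes f :: "'a::euclidean_space \<Rightarrow> real" and Q :: "'a \<Rightarrow> 'a" and q :: 'a and c :: real
  assumes linear: "linear Q"
    and selfadjoint: "x \<bullet> Q y = Q x \<bullet> y"
    and f_eq: "f x = 1 / 2 * (x \<bullet> Q x) + q \<bullet> x + c"
begin

abbreviation "grad x \<equiv> Q x + q"

lemma expansion: "f y = f x + grad x \<bullet> (y - x) + 1 / 2 * ((y - x) \<bullet> Q (y - x))"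
  using selfadjoint[of x y]
  by (simp add: f_eq linear_diff[OF linear] inner_diff_left inner_diff_right inner_add_left
      inner_commute algebra_simps)

lemma bounded: obtains B where "B > 0" "\<And>x. norm (Q x) \<le> B * norm x"
  using linear_bounded_pos[OF linear] by metis

lemma form_bounded: obtains B where "B > 0" "\<And>x. \<bar>x \<bullet> Q x\<bar> \<le> B * (norm x)\<^sup>2"
proof -
  obtain B where B: "B > 0" "\<And>x. norm (Q x) \<le> B * norm x"
    using bounded by metis
  have "\<bar>x \<bullet> Q x\<bar> \<le> B * (norm x)\<^sup>2" for x
    using Cauchy_Schwarz_ineq2[of x "Q x"] mult_left_mono[OF B(2), of "norm x" x]
    by (simp add: power2_eq_square algebra_simps)
  with B(1) show thesis
    by (rule that)
qed

lemma minimizer_variational_inequality: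
  assumes "convex \<Omega>" "x \<in> \<Omega>" "z \<in> \<Omega>" and min: "\<And>w. w \<in> \<Omega> \<Longrightarrow> f x \<le> f w"
  shows "grad x \<bullet> (z - x) \<ge> 0"
proof (rule tendsto_lowerbound)
  \<comment> \<open>\<open>?g t\<close> is the difference quotient of \<open>f\<close> at
    \<open>x\<close> in the direction \<open>z - x\<close>.\<close>
  let ?g = "\<lambda>t. grad x \<bullet> (z - x) + t / 2 * ((z - x) \<bullet> Q (z - x))"
  have "(?g \<longlongrightarrow> grad x \<bullet> (z - x) + 0 / 2 * ((z - x) \<bullet> Q (z - x))) (at_right 0)"
    by (intro tendsto_intros) auto
  then show "(?g \<longlongrightarrow> grad x \<bullet> (z - x)) (at_right 0)"
    by simp
  have "?g t \<ge> 0" if t: "0 < t" "t < 1" for t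
  proof -
    have "x + t *\<^sub>R (z - x) \<in> \<Omega>"
      using convexD_alt[OF assms(1-3), of t] t by (simp add: algebra_simps)
    from min[OF this] have "f x \<le> f (x + t *\<^sub>R (z - x))" .
    also have "\<dots> = f x + t * ?g t"
      using expansion[of "x + t *\<^sub>R (z - x)" x]
      by (simp add: linear_scale[OF linear] distrib_left)
    finally have "0 \<le> t * ?g t"
      by simp
    with t show ?thesis
      by (simp add: zero_le_mult_iff)
  qed
  then show "eventually (\<lambda>t. 0 \<le> ?g t) (at_right 0)"
    unfolding eventually_at_right_field by (intro exI[of _ 1]) auto
qed auto

text \<open>The multipliers of a nearly stationary point range over the cone of its active
  constraints. For a fixed active set \<open>J\<close> the pairs of a point and a residual then form a
  polyhedron, on whose fibre over the residual \<open>0\<close> the function is constant.\<close>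

lemma stationary_value_error_bound:
  assumes "polyhedron \<Omega>"
  obtains V C \<epsilon> where "finite V" "C \<ge> 0" "\<epsilon> > 0"
    "\<And>x v. \<lbrakk>x \<in> \<Omega>; \<And>z. z \<in> \<Omega> \<Longrightarrow> (v - grad x) \<bullet> (z - x) \<le> 0; norm v < \<epsilon>\<rbrakk>
       \<Longrightarrow> \<exists>s\<in>V. \<bar>f x - s\<bar> \<le> C * (norm v)\<^sup>2"
proof -
  obtain I :: "'a set set" and a b
    where I: "finite I" and \<Omega>: "\<Omega> = {x. \<forall>i\<in>I. a i \<bullet> x \<le> b i}"
    using assms by (rule polyhedron_inequalitiesE)
  define G where "G J = {(x, v). x \<in> \<Omega> \<and> (\<forall>i\<in>J. a i \<bullet> x = b i) \<and>
    v - grad x \<in> convex_cone hull (a ` J)}" for J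
  have G: "polyhedron (G J)" if "J \<subseteq> I" for J
  proof -
    have J: "finite J"
      using that I finite_subset by blast
    have "{x. \<forall>i\<in>J. a i \<bullet> x = b i} = \<Inter> ((\<lambda>i. {x. a i \<bullet> x = b i}) ` J)"
      by auto
    then have "polyhedron {x. \<forall>i\<in>J. a i \<bullet> x = b i}"
      using J by (auto intro!: polyhedron_hyperplane)
    then have "polyhedron (\<Omega> \<inter> {x. \<forall>i\<in>J. a i \<bullet> x = b i})"
      using assms by blast
    then have 1: "polyhedron {p :: 'a \<times> 'a. fst p + 0 \<in> \<Omega> \<inter> {x. \<forall>i\<in>J. a i \<bullet> x = b i}}"
      by (rule polyhedron_affine_vimage) (rule linear_fst)
    have "linear (\<lambda>p. snd p - Q (fst p))"
      by (intro linearI)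
         (auto simp: linear_add[OF linear] linear_scale[OF linear] algebra_simps)
    with polyhedron_convex_cone_hull have
      2: "polyhedron {p. snd p - Q (fst p) + - q \<in> convex_cone hull (a ` J)}"
      using J by (intro polyhedron_affine_vimage) auto
    have "G J = {p. fst p + 0 \<in> \<Omega> \<inter> {x. \<forall>i\<in>J. a i \<bullet> x = b i}} \<inter>
        {p. snd p - Q (fst p) + - q \<in> convex_cone hull (a ` J)}"
      by (auto simp: G_def algebra_simps)
    then show ?thesis
      using 1 2 by (simp only: polyhedron_Int)
  qed
  obtain B where B: "B > 0" "\<And>x. \<bar>x \<bullet> Q x\<bar> \<le> B * (norm x)\<^sup>2"
    using form_bounded by metis
  \<comment> \<open>The multipliers at \<open>y\<close> are supported on \<open>J\<close>, and
    \<open>x - y\<close> is orthogonal to every \<open>a i\<close> with \<open>i\<close> in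
    \<open>J\<close>; hence the first-order term vanishes.\<close>
  have diff: "f x - f y = 1 / 2 * ((x - y) \<bullet> Q (x - y))"
    if "(x, v) \<in> G J" "(y, 0) \<in> G J" for x y v J
  proof -
    have "(0 - grad y) \<bullet> (x - y) = 0"
    proof (rule convex_cone_hull_orthogonal)
      show "0 - grad y \<in> convex_cone hull (a ` J)"
        using that by (simp add: G_def)
    qed (use that in \<open>auto simp: G_def inner_diff_right\<close>)
    then have "grad y \<bullet> (x - y) = 0"
      by (metis diff_0 inner_minus_left neg_equal_0_iff_equal)
    then show ?thesis
      using expansion[of x y] by linarith
  qed
  \<comment> \<open>The quadratic form is even, so exchanging \<open>x\<close> and \<open>y\<close>
    in \<open>diff\<close> shows that the difference equals its own negative.\<close>
  have const: "f x = f y" if "(x, 0) \<in> G J" "(y, 0) \<in> G J" for x y J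
    using diff[OF that] diff[OF that(2,1)] linear_diff[OF linear, of x y]
      linear_diff[OF linear, of y x]
    by (simp add: inner_diff_left inner_diff_right)
  \<comment> \<open>The choice is arbitrary if the fibre over 0 is empty, but then no pair in
    \<open>G J\<close> has a residual below the threshold obtained from
    \<open>polyhedron_error_bound\<close>.\<close>
  define s where "s J = f (SOME y. (y, 0) \<in> G J)" for J
  have s: "f y = s J" if "(y, 0) \<in> G J" for y J
    unfolding s_def by (rule const[OF that]) (use that in \<open>rule someI\<close>)
  have "\<exists>C \<epsilon>. C \<ge> 0 \<and> \<epsilon> > 0 \<and> (\<forall>x v. (x, v) \<in> G J \<longrightarrow> norm v < \<epsilon> \<longrightarrow>
      \<bar>f x - s J\<bar> \<le> C * (norm v)\<^sup>2)" if J: "J \<subseteq> I" for J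
  proof -
    obtain C \<epsilon> where C: "C \<ge> 0" "\<epsilon> > 0"
      "\<And>x v. \<lbrakk>(x, v) \<in> G J; norm v < \<epsilon>\<rbrakk> \<Longrightarrow> \<exists>y. (y, 0) \<in> G J \<and> norm (x - y) \<le> C * norm v"
      using polyhedron_error_bound[OF G[OF J]] by metis
    have "\<bar>f x - s J\<bar> \<le> (B * C\<^sup>2) * (norm v)\<^sup>2" if xv: "(x, v) \<in> G J" "norm v < \<epsilon>" for x v
    proof -
      obtain y where y: "(y, 0) \<in> G J" "norm (x - y) \<le> C * norm v"
        using C(3)[OF xv] by blast
      have "\<bar>f x - s J\<bar> = 1 / 2 * \<bar>(x - y) \<bullet> Q (x - y)\<bar>"
        using diff[OF xv(1) y(1)] s[OF y(1)] by linarith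
      also have "\<dots> \<le> B * (norm (x - y))\<^sup>2"
        using B(2)[of "x - y"] by simp
      also have "\<dots> \<le> B * (C * norm v)\<^sup>2"
        using B(1) y(2) by (intro mult_left_mono power_mono) auto
      finally show ?thesis
        by (simp add: power_mult_distrib)
    qed
    then show ?thesis
      using B(1) C(1,2) by (intro exI[of _ "B * C\<^sup>2"] exI[of _ \<epsilon>]) auto
  qed
  then obtain C \<epsilon> where C: "\<And>J. J \<subseteq> I \<Longrightarrow> C J \<ge> 0" and \<epsilon>: "\<And>J. J \<subseteq> I \<Longrightarrow> \<epsilon> J > 0"
    and bound: "\<And>J x v. \<lbrakk>J \<subseteq> I; (x, v) \<in> G J; norm v < \<epsilon> J\<rbrakk> \<Longrightarrow> \<bar>f x - s J\<bar> \<le> C J * (norm v)\<^sup>2"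
    by metis
  show thesis
  proof (rule that[of "s ` Pow I" "sum C (Pow I)" "Min (\<epsilon> ` Pow I)"])
    show "0 < Min (\<epsilon> ` Pow I)"
      using I \<epsilon> by (subst Min_gr_iff) auto
    show "0 \<le> sum C (Pow I)"
      using C by (intro sum_nonneg) auto
    fix x v
    assume x: "x \<in> \<Omega>" and w: "\<And>z. z \<in> \<Omega> \<Longrightarrow> (v - grad x) \<bullet> (z - x) \<le> 0"
      and v: "norm v < Min (\<epsilon> ` Pow I)"
    define J where "J = {i\<in>I. a i \<bullet> x = b i}"
    have J: "J \<in> Pow I"
      by (auto simp: J_def)
    have "v - grad x \<in> convex_cone hull (a ` J)"
      unfolding J_def using x w by (intro normal_vector_in_active_cone I) (auto simp: \<Omega>)
    then have "(x, v) \<in> G J"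
      using x by (auto simp: G_def J_def)
    moreover have "norm v < \<epsilon> J"
      using v J I by (subst (asm) Min_gr_iff) auto
    ultimately have "\<bar>f x - s J\<bar> \<le> C J * (norm v)\<^sup>2"
      using J by (intro bound) auto
    also have "C J \<le> sum C (Pow I)"
      using J C I by (intro member_le_sum) auto
    finally show "\<exists>s\<in>s ` Pow I. \<bar>f x - s\<bar> \<le> sum C (Pow I) * (norm v)\<^sup>2"
      using J by (auto simp: mult_right_mono)
  qed (use I in auto)
qed

end

section \<open>Sequences\<close>

text \<open>Eliminating \<open>d k\<close> between \<open>descent\<close> and \<open>bound\<close>
  makes \<open>D\<close> contract up to a geometric error. \<open>D\<close> may fall below its limit
  0, but only by a geometric amount, so the differences in \<open>descent\<close> control
  \<open>(d k)\<^sup>2\<close>. Taking roots turns the rate \<open>s\<close> into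
  \<open>sqrt s\<close>.\<close>

lemma geometric_decay:
  fixes D d :: "nat \<Rightarrow> real"
  assumes r: "0 < r" "r < 1" and m: "m > 0" and A: "A \<ge> 0" and B: "B > 0"
    and descent: "\<And>k. k \<ge> N \<Longrightarrow> D (Suc k) + m * (d k)\<^sup>2 \<le> D k + A * r ^ k"
    and bound: "\<And>k. k \<ge> N \<Longrightarrow> D (Suc k) \<le> B * ((d k)\<^sup>2 + r ^ k)"
    and lim: "D \<longlonglongrightarrow> 0"
  obtains C s where "0 < s" "s < 1" "\<And>k. k \<ge> N \<Longrightarrow> \<bar>d k\<bar> \<le> C * s ^ k"
proof -
  define \<kappa> where "\<kappa> = m / B"
  define \<theta> where "\<theta> = 1 / (1 + \<kappa>)"
  have \<kappa>: "\<kappa> > 0"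
    using m B by (simp add: \<kappa>_def)
  then have \<theta>: "0 < \<theta>" "\<theta> < 1"
    by (auto simp: \<theta>_def)
  define A' where "A' = A + m"
  have A': "A' > 0"
    using A m by (simp add: A'_def)
  have contr: "D (Suc k) \<le> \<theta> * D k + A' * r ^ k" if k: "k \<ge> N" for k
  proof -
    have "\<kappa> * D (Suc k) \<le> \<kappa> * (B * ((d k)\<^sup>2 + r ^ k))"
      using bound[OF k] \<kappa> by (intro mult_left_mono) auto
    also have "\<dots> = m * (d k)\<^sup>2 + m * r ^ k"
      using B by (simp add: \<kappa>_def algebra_simps)
    finally have "(1 + \<kappa>) * D (Suc k) \<le> D k + A' * r ^ k"
      using descent[OF k] by (simp add: A'_def algebra_simps)
    then have "D (Suc k) \<le> (D k + A' * r ^ k) / (1 + \<kappa>)"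
      using \<kappa> by (simp add: pos_le_divide_eq mult.commute)
    also have "\<dots> = \<theta> * D k + \<theta> * (A' * r ^ k)"
      by (simp add: \<theta>_def add_divide_distrib)
    also have "\<theta> * (A' * r ^ k) \<le> 1 * (A' * r ^ k)"
      using \<theta> A' r by (intro mult_right_mono) auto
    finally show ?thesis
      by simp
  qed
  \<comment> \<open>A rate strictly above \<open>\<theta>\<close> leaves room to absorb the
    perturbation of rate \<open>r\<close>.\<close>
  obtain s where s: "max \<theta> r < s" "s < 1"
    using dense[of "max \<theta> r" 1] \<theta> r by auto
  have s0: "s > 0"
    using s \<theta> by auto
  \<comment> \<open>The first argument of \<open>max\<close> carries the induction step, where
    \<open>\<theta> * E + A' \<le> E * s\<close> is wanted; the second carries the base
    case.\<close>
  define E where "E = max (A' / (s - \<theta>)) (\<bar>D N\<bar> / s ^ N)"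
  have E: "E \<ge> 0" "A' \<le> E * (s - \<theta>)"
  proof -
    have "A' / (s - \<theta>) \<le> E"
      by (simp add: E_def)
    then show "A' \<le> E * (s - \<theta>)"
      using s by (simp add: field_simps)
    show "E \<ge> 0"
      using s0 by (simp add: E_def le_max_iff_disj)
  qed
  have upper: "D k \<le> E * s ^ k" if "k \<ge> N" for k
    using that
  proof (induction k rule: dec_induct)
    case base
    have "\<bar>D N\<bar> / s ^ N \<le> E"
      by (simp add: E_def)
    then show ?case
      using s0 by (simp add: field_simps)
  next
    case (step k)
    have "D (Suc k) \<le> \<theta> * D k + A' * r ^ k"
      using contr step.hyps by simp
    also have "\<dots> \<le> \<theta> * (E * s ^ k) + (E * (s - \<theta>)) * s ^ k"
      using step.IH \<theta> E A' r s by (intro add_mono mult_left_mono mult_mono power_mono) auto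
    also have "\<dots> = E * s ^ Suc k"
      by (simp add: algebra_simps)
    finally show ?case .
  qed
  \<comment> \<open>\<open>A'' * r ^ k\<close> is the sum of all errors from index \<open>k\<close>
    on. Adding it makes \<open>D\<close> nonincreasing with limit 0, hence nonnegative.\<close>
  define A'' where "A'' = A / (1 - r)"
  have A'': "A'' \<ge> 0"
    using A r by (simp add: A''_def)
  have lower: "D k + A'' * r ^ k \<ge> 0" if "k \<ge> N" for k
  proof (rule tendsto_upperbound)
    have "(\<lambda>n. D n + A'' * r ^ n) \<longlonglongrightarrow> 0 + A'' * 0"
      using r by (intro tendsto_intros lim LIMSEQ_power_zero) auto
    then show "(\<lambda>n. D n + A'' * r ^ n) \<longlonglongrightarrow> 0"
      by simp
    have "D n + A'' * r ^ n \<le> D k + A'' * r ^ k" if "n \<ge> k" for n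
      using that
    proof (induction n rule: dec_induct)
      case (step n)
      have "A * r ^ n + A'' * r ^ Suc n = A'' * r ^ n"
        using r by (simp add: A''_def field_simps)
      moreover have "D (Suc n) \<le> D n + A * r ^ n"
        using descent[of n] step.hyps \<open>k \<ge> N\<close> m zero_le_power2[of "d n"]
        by (smt (verit) le_trans mult_nonneg_nonneg)
      ultimately show ?case
        using step.IH by linarith
    qed simp
    then show "eventually (\<lambda>n. D n + A'' * r ^ n \<le> D k + A'' * r ^ k) sequentially"
      unfolding eventually_sequentially by blast
  qed auto
  have sq: "(d k)\<^sup>2 \<le> (E + A'' + A) / m * s ^ k" if k: "k \<ge> N" for k
  proof -
    have "r ^ Suc k \<le> r ^ k" "r ^ k \<le> s ^ k"
      using r s by (auto intro: power_mono simp: mult_left_le_one_le)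
    then have rs: "r ^ Suc k \<le> s ^ k" "r ^ k \<le> s ^ k"
      by auto
    have "m * (d k)\<^sup>2 \<le> D k - D (Suc k) + A * r ^ k"
      using descent[OF k] by simp
    also have "\<dots> \<le> E * s ^ k + A'' * r ^ Suc k + A * r ^ k"
      using upper[OF k] lower[of "Suc k"] k by simp
    also have "\<dots> \<le> E * s ^ k + A'' * s ^ k + A * s ^ k"
      using rs A A'' E by (intro add_mono mult_left_mono) auto
    finally show ?thesis
      using m by (simp add: field_simps)
  qed
  show thesis
  proof (rule that[of "sqrt s" "sqrt ((E + A'' + A) / m)"])
    fix k assume "k \<ge> N"
    from real_sqrt_le_mono[OF sq[OF this]]
    have "\<bar>d k\<bar> \<le> sqrt ((E + A'' + A) / m * s ^ k)"
      by (simp only: real_sqrt_abs)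
    then show "\<bar>d k\<bar> \<le> sqrt ((E + A'' + A) / m) * sqrt s ^ k"
      by (simp only: real_sqrt_mult real_sqrt_power)
  qed (use s s0 in auto)
qed

text \<open>Passes from an eventual bound to one for all indices: the finitely many initial ratios
  are added to the constant, and the summand 1 keeps it positive.\<close>

lemma eventually_geometric_bound:
  fixes a :: "nat \<Rightarrow> 'a::real_normed_vector"
  assumes r: "0 < r" and bound: "\<And>k. k \<ge> N \<Longrightarrow> norm (a k) \<le> C * r ^ k"
  obtains K where "K > 0" "\<And>k. norm (a k) \<le> K * r ^ k"
proof -
  define K where "K = 1 + \<bar>C\<bar> + (\<Sum>i<N. norm (a i) / r ^ i)"
  have nn: "(\<Sum>i<N. norm (a i) / r ^ i) \<ge> 0"
    using r by (intro sum_nonneg) auto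
  have "norm (a k) \<le> K * r ^ k" for k
  proof (cases "k \<ge> N")
    case True
    have "C * r ^ k \<le> K * r ^ k"
      using r nn by (intro mult_right_mono) (auto simp: K_def)
    then show ?thesis
      using bound[OF True] by linarith
  next
    case False
    have "norm (a k) / r ^ k \<le> (\<Sum>i<N. norm (a i) / r ^ i)"
      using False r by (intro member_le_sum) auto
    then have "norm (a k) / r ^ k \<le> K"
      by (simp add: K_def)
    then show ?thesis
      using r by (simp add: field_simps)
  qed
  moreover have "K > 0"
    using nn by (simp add: K_def)
  ultimately show thesis
    using that by blast
qed

lemma geometric_steps_converge_R_linearly:
  fixes x :: "nat \<Rightarrow> 'a::banach"
  assumes s: "0 < s" "s < 1" and step: "\<And>k. k \<ge> N \<Longrightarrow> norm (x (Suc k) - x k) \<le> C * s ^ k"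
  obtains l where "x \<longlonglongrightarrow> l" "converges_R_linearly x l"
proof -
  obtain K where K: "K > 0" "\<And>k. norm (x (Suc k) - x k) \<le> K * s ^ k"
    using eventually_geometric_bound[where a = "\<lambda>k. x (Suc k) - x k", OF s(1) step] by metis
  have geo: "(\<lambda>k. K * s ^ (k + n)) sums (K * s ^ n / (1 - s))" for n
    using sums_mult[OF geometric_sums[of s], of "K * s ^ n"] s
    by (simp add: power_add mult_ac)
  have summ: "summable (\<lambda>k. x (Suc k) - x k)"
    by (rule summable_comparison_test'[where N = 0 and g = "\<lambda>k. K * s ^ k"])
       (use K geo[of 0] in \<open>auto simp: sums_iff\<close>)
  define l where "l = x 0 + (\<Sum>k. x (Suc k) - x k)"
  have "(\<lambda>n. x 0 + (\<Sum>k<n. x (Suc k) - x k)) \<longlonglongrightarrow> l"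
    unfolding l_def by (intro tendsto_intros summable_LIMSEQ summ)
  then have l: "x \<longlonglongrightarrow> l"
    by (simp add: sum_lessThan_telescope)
  have "norm (x n - l) \<le> K / (1 - s) * s ^ n" for n
  proof -
    have "(\<lambda>k. x (Suc (k + n)) - x (k + n)) sums (l - x (0 + n))"
      using telescope_sums[OF LIMSEQ_ignore_initial_segment[OF l, of n]] by simp
    then have "norm (l - x n) = norm (\<Sum>k. x (Suc (k + n)) - x (k + n))"
      by (simp add: sums_iff)
    also have "\<dots> \<le> (\<Sum>k. K * s ^ (k + n))"
      using K geo[of n] by (intro norm_suminf_le) (auto simp: sums_iff)
    also have "\<dots> = K / (1 - s) * s ^ n"
      using geo[of n] by (simp add: sums_iff)
    finally show ?thesis
      by (simp add: norm_minus_commute)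
  qed
  then have "converges_R_linearly x l"
    unfolding converges_R_linearly_def using K s
    by (intro exI[of _ "K / (1 - s)"] exI[of _ s]) auto
  with l show thesis
    by (rule that)
qed

section \<open>The inexact proximal point method\<close>

context quadratic
begin

text \<open>Links the first-order condition at the limit to the regular subdifferential: the error
  it leaves is of second order in the distance.\<close>

lemma variational_inequality_lower_bound:
  obtains B where "\<And>x z. grad x \<bullet> (z - x) \<ge> 0 \<Longrightarrow> f z - f x \<ge> - B * (norm (z - x))\<^sup>2"
proof -
  obtain B where B: "B > 0" "\<And>x. \<bar>x \<bullet> Q x\<bar> \<le> B * (norm x)\<^sup>2"
    using form_bounded by metis
  show thesis
  proof (rule that)
    show "f z - f x \<ge> - B * (norm (z - x))\<^sup>2" if "grad x \<bullet> (z - x) \<ge> 0" for x z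
      using that expansion[of z x] B(2)[of "z - x"] by (simp add: abs_le_iff)
  qed
qed

lemma proximal_step_variational_inequality:
  fixes M :: "'a \<Rightarrow> 'a"
  assumes M: "linear M" "\<And>x y. x \<bullet> M y = M x \<bullet> y"
    and "convex \<Omega>" "x \<in> \<Omega>" "z \<in> \<Omega>"
    and min: "\<And>w. w \<in> \<Omega> \<Longrightarrow>
      f x + 1 / 2 * ((x - y) \<bullet> M (x - y)) \<le> f w + 1 / 2 * ((w - y) \<bullet> M (w - y))"
  shows "(grad x + M (x - y)) \<bullet> (z - x) \<ge> 0"
proof -
  \<comment> \<open>The proximal term only shifts the coefficients: the gradient of the sum at
    \<open>w\<close> is \<open>grad w + M (w - y)\<close>.\<close>
  interpret P: quadratic "\<lambda>w. f w + 1 / 2 * ((w - y) \<bullet> M (w - y))" "\<lambda>w. Q w + M w" "q - M y"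
    "c + 1 / 2 * (y \<bullet> M y)"
  proof (rule quadratic.intro)
    show "linear (\<lambda>w. Q w + M w)"
      using linear M(1) by (rule linear_compose_add)
  qed (use selfadjoint M(2) in
      \<open>auto simp: f_eq linear_diff[OF M(1)] algebra_simps inner_add_left inner_add_right
        inner_diff_left inner_diff_right inner_commute\<close>)
  show ?thesis
    using P.minimizer_variational_inequality[OF assms(3-5) min]
    by (simp add: linear_diff[OF M(1)] algebra_simps)
qed

lemma inexact_proximal_point_converges:
  fixes M :: "'a \<Rightarrow> 'a" and x e :: "nat \<Rightarrow> 'a"
  assumes \<Omega>: "polyhedron \<Omega>" "bdd_below (f ` \<Omega>)"
    and M: "linear M" "\<And>x y. x \<bullet> M y = M x \<bullet> y"
    and m: "m > 0" "\<And>x. m * (norm x)\<^sup>2 \<le> x \<bullet> M x"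
    and \<rho>: "0 < \<rho>" "\<rho> < 1" and e: "\<And>k. norm (e k) \<le> K * \<rho> ^ k"
    and x: "\<And>k. x (Suc k) \<in> \<Omega>"
    and min: "\<And>k w. w \<in> \<Omega> \<Longrightarrow>
      f (x (Suc k)) + 1 / 2 * ((x (Suc k) - (x k + e k)) \<bullet> M (x (Suc k) - (x k + e k)))
      \<le> f w + 1 / 2 * ((w - (x k + e k)) \<bullet> M (w - (x k + e k)))"
  obtains l where "l \<in> \<Omega>" "\<And>z. z \<in> \<Omega> \<Longrightarrow> grad l \<bullet> (z - l) \<ge> 0" "converges_R_linearly x l"
proof -
  define d where "d k = x (Suc k) - x k" for k
  \<comment> \<open>The residual of the step: by optimality of the subproblem,
    \<open>v k - grad (x (Suc k))\<close> is normal to \<open>\<Omega>\<close> at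
    \<open>x (Suc k)\<close>.\<close>
  define v where "v k = - M (d k - e k)" for k
  \<comment> \<open>The errors enter every estimate below through their squares.\<close>
  define r where "r = \<rho>\<^sup>2"
  have r: "0 < r" "r < 1"
    using \<rho> by (auto simp: r_def power_less_one_iff)
  have e_sq: "(norm (e k))\<^sup>2 \<le> K\<^sup>2 * r ^ k" for k
    using power_mono[OF e[of k], of 2] by (simp add: r_def power_mult_distrib flip: power_mult)
       (simp add: mult.commute)
  obtain \<beta> where \<beta>: "\<beta> > 0" "\<And>x. norm (M x) \<le> \<beta> * norm x"
    using linear_bounded_pos[OF M(1)] by metis
  have vi: "(v k - grad (x (Suc k))) \<bullet> (z - x (Suc k)) \<le> 0" if "z \<in> \<Omega>" for k z
  proof -
    have "(grad (x (Suc k)) + M (x (Suc k) - (x k + e k))) \<bullet> (z - x (Suc k)) \<ge> 0"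
      by (rule proximal_step_variational_inequality[OF M polyhedron_imp_convex[OF \<Omega>(1)] x that min])
    moreover have "v k = - M (x (Suc k) - (x k + e k))"
      by (simp add: v_def d_def algebra_simps)
    ultimately show ?thesis
      by (simp add: inner_diff_left inner_add_left)
  qed
  define A where "A = \<beta>\<^sup>2 / m * K\<^sup>2"
  have A: "A \<ge> 0"
    using m by (simp add: A_def)
  \<comment> \<open>The comparison point is \<open>x k\<close>, which is feasible only from index 1
    on because the starting point is arbitrary.\<close>
  have descent: "f (x (Suc k)) + m / 4 * (norm (d k))\<^sup>2 \<le> f (x k) + A * r ^ k" if k: "k \<ge> 1" for k
  proof -
    have "x k \<in> \<Omega>"
      using x[of "k - 1"] k by simp
    moreover have "x (Suc k) - (x k + e k) = d k - e k" "x k - (x k + e k) = - e k"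
      by (simp_all add: d_def)
    ultimately have
      "f (x (Suc k)) + 1 / 2 * ((d k - e k) \<bullet> M (d k - e k)) \<le> f (x k) + 1 / 2 * (e k \<bullet> M (e k))"
      using min[of "x k" k]
      by (simp only: linear_neg[OF M(1)] inner_minus_left inner_minus_right minus_minus)
    then have "f (x (Suc k)) + 1 / 2 * (d k \<bullet> M (d k)) \<le> f (x k) + d k \<bullet> M (e k)"
      using M(2)[of "e k" "d k"]
      by (simp add: linear_diff[OF M(1)] inner_diff_left inner_diff_right inner_commute algebra_simps)
    moreover have "d k \<bullet> M (e k) \<le> m / 4 * (norm (d k))\<^sup>2 + A * r ^ k"
    proof -
      have "d k \<bullet> M (e k) \<le> norm (d k) * (\<beta> * norm (e k))"
        using norm_cauchy_schwarz[of "d k" "M (e k)"] mult_left_mono[OF \<beta>(2)[of "e k"], of "norm (d k)"]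
        by simp
      also have "\<dots> \<le> m / 4 * (norm (d k))\<^sup>2 + \<beta>\<^sup>2 / m * (norm (e k))\<^sup>2"
      proof -
        \<comment> \<open>Young's inequality: half of the coercive term
          \<open>m / 2 * (norm (d k))\<^sup>2\<close> pays for the cross term, which leaves
          \<open>m / 4\<close> and fixes the constant \<open>A\<close>.\<close>
        have "0 \<le> (m / 2 * norm (d k) - \<beta> * norm (e k))\<^sup>2 / m"
          using m by simp
        then show ?thesis
          using m by (simp add: power2_eq_square field_simps)
      qed
      also have "\<beta>\<^sup>2 / m * (norm (e k))\<^sup>2 \<le> A * r ^ k"
        using mult_left_mono[OF e_sq, of "\<beta>\<^sup>2 / m" k] m by (simp add: A_def mult.assoc)
      finally show ?thesis
        by simp
    qed
    ultimately show ?thesis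
      using m(2)[of "d k"] by linarith
  qed
  \<comment> \<open>Adding the sum of the errors still to come turns approximate descent into true
    monotonicity.\<close>
  define F where "F k = f (x (Suc k)) + A / (1 - r) * r ^ Suc k" for k
  have F_descent: "F (Suc k) + m / 4 * (norm (d (Suc k)))\<^sup>2 \<le> F k" for k
  proof -
    have "A * r ^ Suc k + A / (1 - r) * r ^ Suc (Suc k) = A / (1 - r) * r ^ Suc k"
      using r by (simp add: field_simps)
    then show ?thesis
      using descent[of "Suc k"] by (simp add: F_def)
  qed
  have F_dec: "decseq F"
    unfolding decseq_Suc_iff
  proof
    fix k
    have "0 \<le> m / 4 * (norm (d (Suc k)))\<^sup>2"
      using m by simp
    then show "F (Suc k) \<le> F k"
      using F_descent[of k] by linarith
  qed
  obtain b where b: "\<And>w. w \<in> \<Omega> \<Longrightarrow> b \<le> f w"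
    using \<Omega>(2) by (auto simp: bdd_below_def)
  have "b \<le> F k" for k
    using b[OF x[of k]] A r by (simp add: F_def add_increasing2)
  then obtain L where L: "F \<longlonglongrightarrow> L"
    using decseq_convergent[OF F_dec] by blast
  have "(\<lambda>k. A / (1 - r) * r ^ Suc k) \<longlonglongrightarrow> A / (1 - r) * 0"
    using r by (intro tendsto_intros LIMSEQ_Suc[OF LIMSEQ_power_zero]) auto
  from tendsto_diff[OF L this] have f_lim: "(\<lambda>k. f (x (Suc k))) \<longlonglongrightarrow> L"
    by (simp add: F_def)
  have "(\<lambda>k. 4 / m * (F k - F (Suc k))) \<longlonglongrightarrow> 4 / m * (L - L)"
    by (intro tendsto_intros L LIMSEQ_Suc[OF L])
  then have F_diff: "(\<lambda>k. 4 / m * (F k - F (Suc k))) \<longlonglongrightarrow> 0"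
    by simp
  have d_sq: "norm ((norm (d (Suc k)))\<^sup>2) \<le> 4 / m * (F k - F (Suc k))" for k
    using F_descent[of k] m by (simp add: field_simps)
  have "(\<lambda>k. (norm (d (Suc k)))\<^sup>2) \<longlonglongrightarrow> 0"
    by (rule Lim_null_comparison[OF _ F_diff]) (use d_sq in \<open>simp add: always_eventually\<close>)
  from tendsto_real_sqrt[OF this] have "(\<lambda>k. norm (d (Suc k))) \<longlonglongrightarrow> 0"
    by simp
  then have d_lim: "d \<longlonglongrightarrow> 0"
    by (rule LIMSEQ_imp_Suc[OF tendsto_norm_zero_cancel])
  have e_lim: "e \<longlonglongrightarrow> 0"
  proof (rule Lim_null_comparison)
    show "eventually (\<lambda>k. norm (e k) \<le> K * \<rho> ^ k) sequentially"
      using e by simp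
    have "(\<lambda>k. K * \<rho> ^ k) \<longlonglongrightarrow> K * 0"
      using \<rho> by (intro tendsto_intros LIMSEQ_power_zero) auto
    then show "(\<lambda>k. K * \<rho> ^ k) \<longlonglongrightarrow> 0"
      by simp
  qed
  have "v \<longlonglongrightarrow> - M (0 - 0)"
    unfolding v_def
    using M(1) d_lim e_lim
    by (intro tendsto_minus bounded_linear.tendsto[of M] tendsto_diff)
       (simp_all add: linear_conv_bounded_linear)
  then have v_lim: "v \<longlonglongrightarrow> 0"
    by (simp add: linear_0[OF M(1)])
  obtain V C \<epsilon> where V: "finite V" "C \<ge> 0" "\<epsilon> > 0"
    "\<And>x v. \<lbrakk>x \<in> \<Omega>; \<And>z. z \<in> \<Omega> \<Longrightarrow> (v - grad x) \<bullet> (z - x) \<le> 0; norm v < \<epsilon>\<rbrakk>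
       \<Longrightarrow> \<exists>s\<in>V. \<bar>f x - s\<bar> \<le> C * (norm v)\<^sup>2"
    using stationary_value_error_bound[OF \<Omega>(1)] by metis
  \<comment> \<open>\<open>V\<close> is finite, so its members other than \<open>L\<close> keep a
    distance from \<open>L\<close>; a critical value closer than \<open>\<delta>\<close> must be
    \<open>L\<close> itself.\<close>
  obtain \<delta> where \<delta>: "\<delta> > 0" "\<And>s. \<lbrakk>s \<in> V; s \<noteq> L\<rbrakk> \<Longrightarrow> \<delta> \<le> dist L s"
    using finite_set_avoid[OF V(1), of L] by metis
  have "(\<lambda>k. C * (norm (v k))\<^sup>2) \<longlonglongrightarrow> C * (norm (0::'a))\<^sup>2"
    by (intro tendsto_intros v_lim)
  then have "eventually (\<lambda>k. C * (norm (v k))\<^sup>2 < \<delta> / 2) sequentially"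
    using \<delta>(1) by (intro order_tendstoD) auto
  moreover have "eventually (\<lambda>k. norm (v k) < \<epsilon>) sequentially"
    using V(3) tendsto_norm_zero[OF v_lim] by (intro order_tendstoD) auto
  moreover have "eventually (\<lambda>k. dist (f (x (Suc k))) L < \<delta> / 2) sequentially"
    using tendstoD[OF f_lim, of "\<delta> / 2"] \<delta>(1) by simp
  ultimately have "eventually (\<lambda>k. \<bar>f (x (Suc k)) - L\<bar> \<le> C * (norm (v k))\<^sup>2) sequentially"
  proof eventually_elim
    case (elim k)
    obtain s where s: "s \<in> V" "\<bar>f (x (Suc k)) - s\<bar> \<le> C * (norm (v k))\<^sup>2"
      using V(4)[OF x vi elim(2)] by blast
    have "dist L s < \<delta>"
      using s(2) elim(1,3) unfolding dist_real_def by linarith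
    then have "s = L"
      using \<delta>(2)[OF s(1)] by force
    with s(2) show ?case
      by simp
  qed
  then obtain N where N: "\<And>k. k \<ge> N \<Longrightarrow> \<bar>f (x (Suc k)) - L\<bar> \<le> C * (norm (v k))\<^sup>2"
    unfolding eventually_sequentially by blast
  \<comment> \<open>\<open>C + 1\<close> in place of \<open>C\<close> makes \<open>B\<close>
    positive even if \<open>C\<close> is 0.\<close>
  define B where "B = 2 * (C + 1) * \<beta>\<^sup>2 * (1 + K\<^sup>2)"
  have v_sq: "(norm (v k))\<^sup>2 \<le> 2 * \<beta>\<^sup>2 * (1 + K\<^sup>2) * ((norm (d k))\<^sup>2 + r ^ k)" for k
  proof -
    have "norm (v k) \<le> \<beta> * (norm (d k) + norm (e k))"
      using order_trans[OF \<beta>(2) mult_left_mono[OF norm_triangle_ineq4]] \<beta>(1)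
      by (simp add: v_def)
    then have "(norm (v k))\<^sup>2 \<le> (\<beta> * (norm (d k) + norm (e k)))\<^sup>2"
      by (intro power_mono) auto
    also have "\<dots> \<le> \<beta>\<^sup>2 * (2 * (norm (d k))\<^sup>2 + 2 * (norm (e k))\<^sup>2)"
      using sum_squares_bound[of "norm (d k)" "norm (e k)"]
      by (auto simp: power_mult_distrib power2_sum intro!: mult_left_mono)
    also have "\<dots> \<le> \<beta>\<^sup>2 * (2 * (1 + K\<^sup>2) * ((norm (d k))\<^sup>2 + r ^ k))"
    proof (rule mult_left_mono)
      have "0 \<le> r ^ k" "0 \<le> K\<^sup>2 * (norm (d k))\<^sup>2"
        using r by auto
      moreover have "(1 + K\<^sup>2) * ((norm (d k))\<^sup>2 + r ^ k)
          = (norm (d k))\<^sup>2 + r ^ k + K\<^sup>2 * (norm (d k))\<^sup>2 + K\<^sup>2 * r ^ k"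
        by (simp add: algebra_simps)
      ultimately show "2 * (norm (d k))\<^sup>2 + 2 * (norm (e k))\<^sup>2 \<le> 2 * (1 + K\<^sup>2) * ((norm (d k))\<^sup>2 + r ^ k)"
        unfolding mult.assoc using e_sq[of k] by linarith
    qed auto
    finally show ?thesis
      by (simp add: algebra_simps)
  qed
  have value_bound: "f (x (Suc k)) - L \<le> B * ((norm (d k))\<^sup>2 + r ^ k)" if "k \<ge> max 1 N" for k
  proof -
    have "f (x (Suc k)) - L \<le> C * (norm (v k))\<^sup>2"
      using N[of k] that by simp
    also have "\<dots> \<le> (C + 1) * (2 * \<beta>\<^sup>2 * (1 + K\<^sup>2) * ((norm (d k))\<^sup>2 + r ^ k))"
      using v_sq V(2) by (intro mult_mono) auto
    finally show ?thesis
      by (simp add: B_def algebra_simps)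
  qed
  have B: "B > 0"
    using V(2) \<beta>(1) unfolding B_def by (intro mult_pos_pos) (auto simp: add_pos_nonneg)
  have "(\<lambda>k. f (x k) - L) \<longlonglongrightarrow> L - L"
    using LIMSEQ_imp_Suc[OF f_lim] by (intro tendsto_intros)
  then have D_lim: "(\<lambda>k. f (x k) - L) \<longlonglongrightarrow> 0"
    by simp
  have m4: "0 < m / 4"
    using m by simp
  have L_descent: "f (x (Suc k)) - L + m / 4 * (norm (d k))\<^sup>2 \<le> f (x k) - L + A * r ^ k"
    if "k \<ge> max 1 N" for k
    using descent[of k] that by simp
  obtain C' s where s: "0 < s" "s < 1"
    and "\<And>k. k \<ge> max 1 N \<Longrightarrow> \<bar>norm (d k)\<bar> \<le> C' * s ^ k"
    using geometric_decay[OF r m4 A B L_descent value_bound D_lim] by metis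
  then have "\<And>k. k \<ge> max 1 N \<Longrightarrow> norm (x (Suc k) - x k) \<le> C' * s ^ k"
    by (simp add: d_def)
  then obtain l where l: "x \<longlonglongrightarrow> l" "converges_R_linearly x l"
    using geometric_steps_converge_R_linearly[OF s] by metis
  show thesis
  proof (rule that[OF _ _ l(2)])
    show "l \<in> \<Omega>"
      using polyhedron_imp_closed[OF \<Omega>(1)] x LIMSEQ_Suc[OF l(1)] by (rule closed_sequentially)
    show "grad l \<bullet> (z - l) \<ge> 0" if z: "z \<in> \<Omega>" for z
    proof -
      \<comment> \<open>For fixed \<open>z\<close> the normality condition passes to the limit,
        since the residuals vanish.\<close>
      have "(\<lambda>k. (v k - grad (x (Suc k))) \<bullet> (z - x (Suc k))) \<longlonglongrightarrow> (0 - grad l) \<bullet> (z - l)"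
        by (intro tendsto_inner tendsto_diff tendsto_add tendsto_const v_lim LIMSEQ_Suc[OF l(1)]
            bounded_linear.tendsto[OF linear[unfolded linear_conv_bounded_linear]])
      then have "(0 - grad l) \<bullet> (z - l) \<le> 0"
        by (rule tendsto_upperbound) (use vi[OF z] in auto)
      then show ?thesis
        by (simp add: inner_diff_left inner_add_left)
    qed
  qed
qed

end

section \<open>Matrix step sizes\<close>

lemma sym_pos_def_matrix_inv:
  fixes \<Sigma> :: "real ^ 'n ^ 'n"
  assumes "sym_pos_def \<Sigma>"
  shows "sym_pos_def (matrix_inv \<Sigma>)"
proof -
  have sym: "transpose \<Sigma> = \<Sigma>" and pos: "\<And>x. x \<noteq> 0 \<Longrightarrow> 0 < x \<bullet> (\<Sigma> *v x)"
    using assms by (auto simp: sym_pos_def_def symmetric_mat_def)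
  have "x = 0" if "\<Sigma> *v x = 0" for x
    using pos[of x] that by auto
  then have "invertible \<Sigma>"
    unfolding invertible_left_inverse matrix_left_invertible_ker by blast
  then have "\<exists>A. \<Sigma> ** A = mat 1 \<and> A ** \<Sigma> = mat 1"
    unfolding invertible_def .
  then have "\<Sigma> ** matrix_inv \<Sigma> = mat 1 \<and> matrix_inv \<Sigma> ** \<Sigma> = mat 1"
    unfolding matrix_inv_def by (rule someI_ex)
  then have right: "\<Sigma> ** matrix_inv \<Sigma> = mat 1"
    by blast
  have "transpose (matrix_inv \<Sigma>) ** \<Sigma> = mat 1"
    using arg_cong[OF right, of transpose] by (simp add: matrix_transpose_mul sym transpose_mat)
  then have "transpose (matrix_inv \<Sigma>) ** (\<Sigma> ** matrix_inv \<Sigma>) = matrix_inv \<Sigma>"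
    by (simp add: matrix_mul_assoc)
  then have "transpose (matrix_inv \<Sigma>) = matrix_inv \<Sigma>"
    by (simp add: right)
  moreover have "0 < x \<bullet> (matrix_inv \<Sigma> *v x)" if "x \<noteq> 0" for x
  proof -
    \<comment> \<open>With \<open>y = matrix_inv \<Sigma> *v x\<close>, the form of the inverse at
      \<open>x\<close> is the form of \<open>\<Sigma>\<close> at \<open>y\<close>.\<close>
    have x: "\<Sigma> *v (matrix_inv \<Sigma> *v x) = x"
      by (simp add: matrix_vector_mul_assoc right)
    then have "matrix_inv \<Sigma> *v x \<noteq> 0"
      using that by force
    from pos[OF this] show ?thesis
      by (simp add: x inner_commute)
  qed
  ultimately show ?thesis
    by (simp add: sym_pos_def_def symmetric_mat_def)
qed

lemma symmetric_mat_selfadjoint: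
  "symmetric_mat M \<Longrightarrow> x \<bullet> (M *v y) = (M *v x) \<bullet> y"
  by (metis dot_lmul_matrix symmetric_mat_def vector_transpose_matrix)

text \<open>\<open>m\<close> is the minimum of the form on the compact unit sphere; homogeneity
  extends the bound to all vectors.\<close>

lemma sym_pos_def_coercive:
  fixes M :: "real ^ 'n ^ 'n"
  assumes "sym_pos_def M"
  obtains m where "m > 0" "\<And>x. m * (norm x)\<^sup>2 \<le> x \<bullet> (M *v x)"
proof -
  have pos: "\<And>x. x \<noteq> 0 \<Longrightarrow> 0 < x \<bullet> (M *v x)"
    using assms by (auto simp: sym_pos_def_def)
  have "continuous_on (sphere 0 1) (\<lambda>x. x \<bullet> (M *v x))"
    by (intro continuous_on_inner continuous_on_id linear_continuous_on
        matrix_vector_mul_bounded_linear)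
  then obtain u where u: "u \<in> sphere 0 1" "\<And>y. y \<in> sphere 0 1 \<Longrightarrow> u \<bullet> (M *v u) \<le> y \<bullet> (M *v y)"
    using continuous_attains_inf[of "sphere 0 1" "\<lambda>x. x \<bullet> (M *v x)"] by auto
  show thesis
  proof (rule that)
    show "u \<bullet> (M *v u) > 0"
      using u(1) by (intro pos) auto
    show "u \<bullet> (M *v u) * (norm x)\<^sup>2 \<le> x \<bullet> (M *v x)" for x
    proof (cases "x = 0")
      case False
      define y where "y = (1 / norm x) *\<^sub>R x"
      have "x = norm x *\<^sub>R y"
        using False by (simp add: y_def)
      then have "x \<bullet> (M *v x) = (norm x)\<^sup>2 * (y \<bullet> (M *v y))"
        by (metis inner_scaleR_left inner_scaleR_right matrix_vector_mult_scaleR mult.assoc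
            power2_eq_square)
      moreover have "u \<bullet> (M *v u) \<le> y \<bullet> (M *v y)"
        using False by (intro u(2)) (simp add: y_def)
      ultimately show ?thesis
        by (simp add: mult_right_mono mult.commute)
    qed simp
  qed
qed

section \<open>Proximal points and stationarity for a function plus an indicator\<close>

lemma prox_indicator:
  fixes f :: "real ^ 'n \<Rightarrow> real"
  assumes "\<Omega> \<noteq> {}" and \<phi>: "\<And>y. \<phi> y = ereal (f y) + delta \<Omega> y"
    and "sym_pos_def (matrix_inv \<Sigma>)" (is "sym_pos_def ?M")
    and p: "p \<in> prox \<Sigma> \<phi> y"
  shows "p \<in> \<Omega>"
    and "w \<in> \<Omega> \<Longrightarrow> f p + 1 / 2 * ((p - y) \<bullet> (?M *v (p - y))) \<le> f w + 1 / 2 * ((w - y) \<bullet> (?M *v (w - y)))"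
proof -
  have nn: "(norm_mat ?M u)\<^sup>2 = u \<bullet> (?M *v u)" for u
    using assms(3) by (cases "u = 0") (auto simp: norm_mat_def sym_pos_def_def less_imp_le)
  have min: "\<phi> p + ereal (1 / 2 * (norm_mat ?M (p - y))\<^sup>2)
      \<le> \<phi> w + ereal (1 / 2 * (norm_mat ?M (w - y))\<^sup>2)" for w
    using p by (auto simp: prox_def is_arg_min_def not_less)
  \<comment> \<open>A feasible competitor makes the minimum finite, which forces \<open>p\<close>
    into \<open>\<Omega>\<close>.\<close>
  obtain w0 where "w0 \<in> \<Omega>"
    using assms(1) by blast
  then show "p \<in> \<Omega>"
    using min[of w0] by (auto simp: \<phi> delta_def split: if_splits)
  then show "f p + 1 / 2 * ((p - y) \<bullet> (?M *v (p - y))) \<le> f w + 1 / 2 * ((w - y) \<bullet> (?M *v (w - y)))"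
    if "w \<in> \<Omega>"
    using min[of w] that by (simp add: \<phi> delta_def nn)
qed

text \<open>On \<open>\<Omega>\<close> the quotient is at least \<open>- B * norm (z - x)\<close>,
  which tends to 0; off \<open>\<Omega>\<close> it is infinite.\<close>

lemma stationary_indicator:
  fixes f :: "real ^ 'n \<Rightarrow> real"
  assumes \<phi>: "\<And>y. \<phi> y = ereal (f y) + delta \<Omega> y" and x: "x \<in> \<Omega>"
    and bound: "\<And>z. z \<in> \<Omega> \<Longrightarrow> f z - f x \<ge> - B * (norm (z - x))\<^sup>2"
  shows "stationary \<phi> x"
proof -
  have "((\<lambda>z. - B * norm (z - x)) \<longlongrightarrow> - B * norm (x - x)) (at x)"
    by (intro tendsto_intros)
  then have "((\<lambda>z. ereal (- B * norm (z - x))) \<longlongrightarrow> 0) (at x)"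
    by (simp add: zero_ereal_def)
  then have "0 = Liminf (at x) (\<lambda>z. ereal (- B * norm (z - x)))"
    by (intro lim_imp_Liminf[symmetric]) auto
  also have "\<dots> \<le> Liminf (at x) (\<lambda>z. (\<phi> z - \<phi> x) / ereal (norm (z - x)))"
  proof (rule Liminf_mono)
    have "ereal (- B * norm (z - x)) \<le> (\<phi> z - \<phi> x) / ereal (norm (z - x))" if z: "z \<noteq> x" for z
    proof (cases "z \<in> \<Omega>")
      case True
      have "- B * norm (z - x) \<le> (f z - f x) / norm (z - x)"
        using bound[OF True] z by (simp add: field_simps power2_eq_square)
      then show ?thesis
        using True x z by (simp add: \<phi> delta_def)
    next
      case False
      then show ?thesis
        using x z by (simp add: \<phi> delta_def)
    qed
    then show "eventually (\<lambda>z. ereal (- B * norm (z - x))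
        \<le> (\<phi> z - \<phi> x) / ereal (norm (z - x))) (at x)"
      by (auto simp: eventually_at_filter)
  qed
  finally show ?thesis
    using x by (simp add: stationary_def \<phi> delta_def)
qed

theorem theorem2p5:
  fixes f :: "real ^ 'n \<Rightarrow> real" and \<phi> :: "real ^ 'n \<Rightarrow> ereal" and \<Omega> :: "(real ^ 'n) set"
    and \<Sigma> :: "real ^ 'n ^ 'n" and x0 :: "real ^ 'n" and e x :: "nat \<Rightarrow> real ^ 'n"
  assumes "polyhedron \<Omega>" and "\<Omega> \<noteq> {}"
    and "quadratic_function f" and "bdd_below (f ` \<Omega>)"
    and "\<And>y. \<phi> y = ereal (f y) + delta \<Omega> y"
    and "sym_pos_def \<Sigma>"
    and "\<exists>\<rho>. 0 < \<rho> \<and> \<rho> < 1 \<and> (\<lambda>k. norm (e k)) \<in> O(\<lambda>k. \<rho> ^ k)"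
    and "x 0 = x0"
    and "\<And>k. x (Suc k) \<in> prox \<Sigma> \<phi> (x k + e k)"
  shows "\<exists>xstar. stationary \<phi> xstar \<and> converges_R_linearly x xstar"
proof -
  obtain Q q c where Q: "symmetric_mat Q" "\<And>x. f x = 1 / 2 * (x \<bullet> (Q *v x)) + q \<bullet> x + c"
    using assms(3) unfolding quadratic_function_def by blast
  interpret quadratic f "(*v) Q" q c
    by (rule quadratic.intro) (use Q in \<open>auto intro: symmetric_mat_selfadjoint\<close>)
  have M: "sym_pos_def (matrix_inv \<Sigma>)"
    using assms(6) by (rule sym_pos_def_matrix_inv)
  then have sym: "symmetric_mat (matrix_inv \<Sigma>)"
    by (simp add: sym_pos_def_def)
  obtain m where m: "m > 0" "\<And>x. m * (norm x)\<^sup>2 \<le> x \<bullet> (matrix_inv \<Sigma> *v x)"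
    using sym_pos_def_coercive[OF M] by metis
  obtain \<rho> where \<rho>: "0 < \<rho>" "\<rho> < 1" "(\<lambda>k. norm (e k)) \<in> O(\<lambda>k. \<rho> ^ k)"
    using assms(7) by blast
  \<comment> \<open>The Landau bound holds only eventually; it is extended to all indices with a
    larger constant.\<close>
  then obtain K' where "eventually (\<lambda>k. norm (e k) \<le> K' * \<rho> ^ k) sequentially"
    by (auto elim!: landau_o.bigE)
  then obtain N where "\<And>k. k \<ge> N \<Longrightarrow> norm (e k) \<le> K' * \<rho> ^ k"
    unfolding eventually_sequentially by blast
  then obtain K where K: "\<And>k. norm (e k) \<le> K * \<rho> ^ k"
    using eventually_geometric_bound[OF \<rho>(1)] by metis
  note step = prox_indicator[OF assms(2,5) M assms(9)]
  obtain l where l: "l \<in> \<Omega>" "\<And>z. z \<in> \<Omega> \<Longrightarrow> (Q *v l + q) \<bullet> (z - l) \<ge> 0" "converges_R_linearly x l"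
    using inexact_proximal_point_converges[where M = "(*v) (matrix_inv \<Sigma>)" and x = x and e = e,
        OF assms(1,4) matrix_vector_mul_linear symmetric_mat_selfadjoint[OF sym] m \<rho>(1,2) K step]
    by blast
  obtain B where "\<And>z. z \<in> \<Omega> \<Longrightarrow> f z - f l \<ge> - B * (norm (z - l))\<^sup>2"
    using variational_inequality_lower_bound l(2) by metis
  then have "stationary \<phi> l"
    by (rule stationary_indicator[OF assms(5) l(1)])
  with l(3) show ?thesis
    by blast
qed

end
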